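(* Let $\mathcal{B}$ be the partial Steiner system determined by the incidence of edges in a finite $k$-regular graph. For the homogeneous degree $k$ polynomial $P(x)=\sum_{I\in\mathcal{B}}\epsilon_Ix_I$ associated with the $k$-regular graph and any choice of signs $\epsilon\in\{\pm1\}^{\mathcal{B}}$, the pair $(h,D^{(k)}P)$ solves the coupled Einstein equations.
   Context: Let $\{e_1,\dots,e_n\}$ be an enumeration of the edge set of the graph. $\mathcal{B}$ is the collection of $k$-element subsets (blocks) $I=\{i_1,\dots,i_k\}$ of $\{1,\dots,n\}$ such that the edges $e_{i_1},\dots,e_{i_k}$ are incident at some vertex of the graph. Let $V$ be the $n$-dimensional real vector space generated by the edges, equipped with the flat Riemannian metric $h$ for which $\{e_1,\dots,e_n\}$ is an ordered orthonormal basis; let $x_1,\dots,x_n$ be the corresponding coordinates and $x_I=x_{i_1}\cdots x_{i_k}$ for $I\in\mathcal{B}$. The sign attached to $I\in\mathcal{B}$ is $\epsilon_I\in\{\pm1\}$. $D$ is the flat Levi-Civita connection of $h$ and $D^{(k)}P$ is the $k$-fold covariant derivative of $P$, a constant symmetric $k$-tensor. For an $h$-trace-free completely symmetric $k$-tensor $\omega$, let $\rho(\omega)_{ij}=\omega_{ia_1\dots a_{k-1}}\omega_j{}^{a_1\dots a_{k-1}}$ (read as $\omega_i\omega_j$ if $k=1$) and $|\omega|^2=\omega^{i_1\dots i_k}\omega_{i_1\dots i_k}$. The pair $(h,\omega)$ solves the coupled Einstein equations with constants $c,\kappa\in\mathbb{R}$ if $\omega$ is trace-free, divergence-free ($D^p\omega_{pi_1\dots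 i_{k-1}}=0$) and Codazzi ($D_i\omega_{ji_1\dots i_{k-1}}=D_j\omega_{ii_1\dots i_{k-1}}$), and $\mathrm{Ric}-\frac12\mathrm{scal}\,h+\frac{n-2}{2n}\kappa h=c\left(\rho(\omega)-\frac12|\omega|^2h\right)$, where $\mathrm{Ric}$ and $\mathrm{scal}$ are the Ricci and scalar curvatures of $h$ (here zero). That $(h,\omega)$ solves the coupled Einstein equations, with no constants specified, means here that for every $c\in\mathbb{R}$ there is $\kappa\in\mathbb{R}$ such that it solves them with constants $c,\kappa$.
   Formalization: The formal theorem assumes k ≥ 3 (with the graph simple); the claim fails for k = 2 (e.g. the triangle, where ρ has off-diagonal entries ±1) and for k = 1 with at least two edges; only the single edge is lost. *)

theory Defs
  imports "HOL-Analysis.Analysis"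
begin

text \<open>
  Tensor fields on \<open>real ^ 'n\<close> are given by their components in the global coordinates:
  \<open>T x [i\<^sub>1, \<dots>, i\<^sub>k]\<close> is the component of the covariant \<open>k\<close>-tensor field \<open>T\<close> at \<open>x\<close>.  Only
  lists of length \<open>k\<close> are meaningful for a field of rank \<open>k\<close>, so every predicate below bounds
  the length of its index lists.
\<close>

type_synonym 'n tensor_field = "real ^ 'n \<Rightarrow> 'n list \<Rightarrow> real"
type_synonym 'n metric_field = "real ^ 'n \<Rightarrow> real ^ 'n ^ 'n"

definition partial_deriv :: "'n::finite \<Rightarrow> (real ^ 'n \<Rightarrow> real) \<Rightarrow> real ^ 'n \<Rightarrow> real" where
  "partial_deriv i f x = frechet_derivative f (at x) (axis i 1)"

text \<open>Smooth means that all iterated partial derivatives are (Frechet) differentiable everywhere.\<close>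

definition smooth_fun :: "(real ^ 'n::finite \<Rightarrow> real) \<Rightarrow> bool" where
  "smooth_fun f \<longleftrightarrow> (\<forall>is x. foldr partial_deriv is f differentiable (at x))"

definition riemannian_metric :: "'n::finite metric_field \<Rightarrow> bool" where
  "riemannian_metric g \<longleftrightarrow>
     (\<forall>i j. smooth_fun (\<lambda>x. g x $ i $ j)) \<and>
     (\<forall>x. transpose (g x) = g x) \<and>
     (\<forall>x v. v \<noteq> 0 \<longrightarrow> v \<bullet> (g x *v v) > 0)"

definition inv_metric :: "'n::finite metric_field \<Rightarrow> real ^ 'n \<Rightarrow> 'n \<Rightarrow> 'n \<Rightarrow> real" where
  "inv_metric g x i j = matrix_inv (g x) $ i $ j"

text \<open>\<open>christoffel g l i j x\<close> is \<open>\<Gamma>\<close> with upper index \<open>l\<close> and lower indices \<open>i\<close>, \<open>j\<close>.\<close>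

definition christoffel :: "'n::finite metric_field \<Rightarrow> 'n \<Rightarrow> 'n \<Rightarrow> 'n \<Rightarrow> real ^ 'n \<Rightarrow> real" where
  "christoffel g l i j x =
     (1/2) * (\<Sum>m\<in>UNIV. inv_metric g x l m *
        (partial_deriv i (\<lambda>y. g y $ j $ m) x
         + partial_deriv j (\<lambda>y. g y $ i $ m) x
         - partial_deriv m (\<lambda>y. g y $ i $ j) x))"

text \<open>
  \<open>riemann g i j m l x\<close> is the coefficient of \<open>\<partial>\<^sub>l\<close> in \<open>R(\<partial>\<^sub>i, \<partial>\<^sub>j) \<partial>\<^sub>m\<close>, where
  \<open>R(X,Y) = [D\<^sub>X, D\<^sub>Y] - D\<^bsub>[X,Y]\<^esub>\<close>; the trace taken in \<open>ricci\<close> makes round spheres positive.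
\<close>

definition riemann :: "'n::finite metric_field \<Rightarrow> 'n \<Rightarrow> 'n \<Rightarrow> 'n \<Rightarrow> 'n \<Rightarrow> real ^ 'n \<Rightarrow> real" where
  "riemann g i j m l x =
     partial_deriv i (christoffel g l j m) x - partial_deriv j (christoffel g l i m) x
     + (\<Sum>p\<in>UNIV. christoffel g l i p x * christoffel g p j m x
                 - christoffel g l j p x * christoffel g p i m x)"

definition ricci :: "'n::finite metric_field \<Rightarrow> 'n \<Rightarrow> 'n \<Rightarrow> real ^ 'n \<Rightarrow> real" where
  "ricci g i j x = (\<Sum>p\<in>UNIV. riemann g p i j p x)"

definition scal :: "'n::finite metric_field \<Rightarrow> real ^ 'n \<Rightarrow> real" where
  "scal g x = (\<Sum>i\<in>UNIV. \<Sum>j\<in>UNIV. inv_metric g x i j * ricci g i j x)"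

text \<open>
  Covariant derivative of covariant tensor fields for the Levi-Civita connection of \<open>g\<close>; the
  index of differentiation is put first.
\<close>

fun cov_deriv :: "'n::finite metric_field \<Rightarrow> 'n tensor_field \<Rightarrow> 'n tensor_field" where
  "cov_deriv g T x [] = 0"
| "cov_deriv g T x (p # is) =
     partial_deriv p (\<lambda>y. T y is) x
     - (\<Sum>s<length is. \<Sum>q\<in>UNIV. christoffel g q p (is ! s) x * T x (is[s := q]))"

definition iterated_cov_deriv ::
    "'n::finite metric_field \<Rightarrow> nat \<Rightarrow> (real ^ 'n \<Rightarrow> real) \<Rightarrow> 'n tensor_field" where
  "iterated_cov_deriv g k f = (cov_deriv g ^^ k) (\<lambda>x is. f x)"

definition smooth_tensor :: "nat \<Rightarrow> 'n::finite tensor_field \<Rightarrow> bool" where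
  "smooth_tensor k \<omega> \<longleftrightarrow> (\<forall>is. length is = k \<longrightarrow> smooth_fun (\<lambda>x. \<omega> x is))"

definition symmetric_tensor :: "nat \<Rightarrow> 'n::finite tensor_field \<Rightarrow> bool" where
  "symmetric_tensor k \<omega> \<longleftrightarrow>
     (\<forall>x is js. length is = k \<and> mset is = mset js \<longrightarrow> \<omega> x is = \<omega> x js)"

definition trace_free :: "'n::finite metric_field \<Rightarrow> nat \<Rightarrow> 'n tensor_field \<Rightarrow> bool" where
  "trace_free g k \<omega> \<longleftrightarrow>
     (\<forall>x is. length is + 2 = k \<longrightarrow>
        (\<Sum>p\<in>UNIV. \<Sum>q\<in>UNIV. inv_metric g x p q * \<omega> x (p # q # is)) = 0)"

definition divergence_free :: "'n::finite metric_field \<Rightarrow> nat \<Rightarrow> 'n tensor_field \<Rightarrow> bool" where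
  "divergence_free g k \<omega> \<longleftrightarrow>
     (\<forall>x is. length is + 1 = k \<longrightarrow>
        (\<Sum>p\<in>UNIV. \<Sum>q\<in>UNIV. inv_metric g x p q * cov_deriv g \<omega> x (q # p # is)) = 0)"

definition codazzi :: "'n::finite metric_field \<Rightarrow> nat \<Rightarrow> 'n tensor_field \<Rightarrow> bool" where
  "codazzi g k \<omega> \<longleftrightarrow>
     (\<forall>x i j is. length is + 1 = k \<longrightarrow>
        cov_deriv g \<omega> x (i # j # is) = cov_deriv g \<omega> x (j # i # is))"

text \<open>For \<open>k = 1\<close> the only list of length \<open>k - 1\<close> is empty and \<open>rho\<close> is \<open>\<omega>\<^sub>i \<omega>\<^sub>j\<close>.\<close>

definition rho :: "'n::finite metric_field \<Rightarrow> nat \<Rightarrow> 'n tensor_field \<Rightarrow> 'n \<Rightarrow> 'n \<Rightarrow> real ^ 'n \<Rightarrow> real"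
  where
  "rho g k \<omega> i j x =
     (\<Sum>as\<in>{as. length as = k - 1}. \<Sum>bs\<in>{bs. length bs = k - 1}.
        (\<Prod>s<k - 1. inv_metric g x (as ! s) (bs ! s)) * \<omega> x (i # as) * \<omega> x (j # bs))"

definition tensor_norm_sq :: "'n::finite metric_field \<Rightarrow> nat \<Rightarrow> 'n tensor_field \<Rightarrow> real ^ 'n \<Rightarrow> real"
  where
  "tensor_norm_sq g k \<omega> x =
     (\<Sum>as\<in>{as. length as = k}. \<Sum>bs\<in>{bs. length bs = k}.
        (\<Prod>s<k. inv_metric g x (as ! s) (bs ! s)) * \<omega> x as * \<omega> x bs)"

definition coupled_einstein ::
    "'n::finite metric_field \<Rightarrow> nat \<Rightarrow> 'n tensor_field \<Rightarrow> real \<Rightarrow> real \<Rightarrow> bool" where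
  "coupled_einstein g k \<omega> c \<kappa> \<longleftrightarrow>
     riemannian_metric g \<and> smooth_tensor k \<omega> \<and> symmetric_tensor k \<omega> \<and>
     trace_free g k \<omega> \<and> divergence_free g k \<omega> \<and> codazzi g k \<omega> \<and>
     (\<forall>x i j.
        ricci g i j x - (1/2) * scal g x * g x $ i $ j
        + (real CARD('n) - 2) / (2 * real CARD('n)) * \<kappa> * g x $ i $ j
        = c * (rho g k \<omega> i j x - (1/2) * tensor_norm_sq g k \<omega> x * g x $ i $ j))"

text \<open>The metric for which the standard basis is orthonormal at every point.\<close>

definition flat_metric :: "'n::finite metric_field" where
  "flat_metric = (\<lambda>x. mat 1)"

definition finite_simple_graph :: "'v set \<Rightarrow> 'v set set \<Rightarrow> bool" where
  "finite_simple_graph V E \<longleftrightarrow> finite V \<and> (\<forall>a\<in>E. a \<subseteq> V \<and> card a = 2)"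

definition regular_graph :: "nat \<Rightarrow> 'v set \<Rightarrow> 'v set set \<Rightarrow> bool" where
  "regular_graph k V E \<longleftrightarrow> (\<forall>v\<in>V. card {a \<in> E. v \<in> a} = k)"

text \<open>
  An enumeration of the edges is a bijection \<open>e\<close> from the index type \<open>'n\<close> onto the edge set,
  so \<open>CARD('n)\<close> is the number of edges, \<open>real ^ 'n\<close> is the vector space generated by the edges,
  and \<open>axis i 1\<close> is the basis vector of the edge \<open>e i\<close>.
\<close>

definition incidence_blocks :: "'v set \<Rightarrow> ('n::finite \<Rightarrow> 'v set) \<Rightarrow> nat \<Rightarrow> 'n set set" where
  "incidence_blocks V e k = {I. card I = k \<and> (\<exists>v\<in>V. \<forall>i\<in>I. v \<in> e i)}"

definition block_poly :: "'n::finite set set \<Rightarrow> ('n set \<Rightarrow> real) \<Rightarrow> real ^ 'n \<Rightarrow> real" where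
  "block_poly B \<epsilon> x = (\<Sum>I\<in>B. \<epsilon> I * (\<Prod>i\<in>I. x $ i))"

end

theory Submission
  imports Defs "HOL-Combinatorics.Multiset_Permutations"
begin

text \<open>
  In flat coordinates covariant derivatives are partial derivatives, and \<open>P\<close> is a sum of
  squarefree monomials of degree \<open>k\<close>.  Hence \<open>D\<^sup>k P\<close> is constant, and its component at
  \<open>i\<^sub>1, \<dots>, i\<^sub>k\<close> is \<open>\<epsilon>\<^sub>I\<close> if the \<open>i\<^sub>s\<close> are distinct and form a block \<open>I\<close>, and \<open>0\<close> otherwise.  Symmetry
  is clear, the trace vanishes because a repeated index gives \<open>0\<close>, and the divergence and Codazzi
  conditions hold because the tensor is constant.

  It remains to compute \<open>\<rho>\<close>, since \<open>|\<omega>|\<^sup>2\<close> is its trace.  A nonzero term of \<open>\<rho>\<^sub>i\<^sub>j\<close> with \<open>i \<noteq> j\<close>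
  would give two distinct blocks with \<open>k - 1 \<ge> 2\<close> common points, but two vertices of a simple graph
  share at most one edge.  On the diagonal the signs are squared away, and \<open>\<rho>\<^sub>i\<^sub>i\<close> counts the
  orderings of \<open>I - {i}\<close> over the blocks \<open>I\<close> through \<open>i\<close>: these blocks are two, one for each end of
  the edge \<open>i\<close>, so \<open>\<rho> = 2 (k - 1)! h\<close>.  With \<open>Ric = 0\<close> both sides of the Einstein equation are multiples
  of \<open>h\<close>, the right one by \<open>- c (k - 1)! (n - 2)\<close>, which \<open>\<kappa> = - 2 n (k - 1)! c\<close> matches.  The
  computation is carried out for any \<open>k\<close>-uniform family of blocks that meet pairwise in at most one
  point and in which every point lies on the same number \<open>r\<close> of blocks; for a graph \<open>r = 2\<close>.
\<close>

section \<open>Flat tensor calculus\<close>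

lemma partial_deriv_eqI:
  "(f has_derivative f') (at x) \<Longrightarrow> partial_deriv i f x = f' (axis i 1)"
  unfolding partial_deriv_def using frechet_derivative_at by metis

lemma partial_deriv_const [simp]: "partial_deriv i (\<lambda>x. c) = (\<lambda>x. 0)"
  by (rule ext, rule partial_deriv_eqI[where f' = "\<lambda>_. 0"]) simp

lemma smooth_fun_const: "smooth_fun (\<lambda>x. c)"
proof -
  have "\<exists>d. foldr partial_deriv is (\<lambda>x. c) = (\<lambda>x. d)" for "is" :: "'a list"
    by (induction "is") auto
  then show ?thesis
    unfolding smooth_fun_def by (metis differentiable_const)
qed

lemma inv_metric_flat [simp]:
  fixes i j :: "'n::finite"
  shows "inv_metric flat_metric x i j = (if i = j then 1 else 0)"
proof -
  have "matrix_inv (mat 1 :: real ^ 'n ^ 'n) = mat 1"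
    unfolding matrix_inv_def by (rule some_equality) auto
  then show ?thesis unfolding inv_metric_def flat_metric_def by (simp only:) (simp add: mat_def)
qed

lemma christoffel_flat [simp]: "christoffel flat_metric l i j = (\<lambda>x. 0)"
  by (rule ext) (simp add: christoffel_def flat_metric_def)

lemma ricci_flat [simp]: "ricci flat_metric i j x = 0"
  by (simp add: ricci_def riemann_def)

lemma scal_flat [simp]: "scal flat_metric x = 0"
  by (simp add: scal_def)

lemma riemannian_metric_flat: "riemannian_metric flat_metric"
  by (auto simp: riemannian_metric_def flat_metric_def smooth_fun_const)

lemma cov_deriv_flat [simp]:
  "cov_deriv flat_metric T x (p # is) = partial_deriv p (\<lambda>y. T y is) x"
  by simp

lemma iterated_cov_deriv_flat:
  "length is = k \<Longrightarrow> iterated_cov_deriv flat_metric k f x is = foldr partial_deriv is f x"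
proof (induction k arbitrary: "is" x)
  case 0
  then show ?case by (simp add: iterated_cov_deriv_def)
next
  case (Suc k)
  then obtain p js where "is": "is = p # js" "length js = k" by (cases "is") auto
  have "(\<lambda>y. (cov_deriv flat_metric ^^ k) (\<lambda>x is. f x) y js) = foldr partial_deriv js f"
    using Suc.IH[OF "is"(2)] by (auto simp: iterated_cov_deriv_def)
  then show ?case by (simp add: iterated_cov_deriv_def "is"(1) del: cov_deriv.simps)
qed

lemma prod_kronecker_lists:
  assumes "length as = m" "length bs = m"
  shows "(\<Prod>s<m. inv_metric flat_metric x (as ! s) (bs ! s)) = (if as = bs then 1 else 0)"
proof (cases "as = bs")
  case False
  then obtain s where "s < m" "as ! s \<noteq> bs ! s" using assms by (metis nth_equalityI)
  then show ?thesis using False by (auto intro!: prod_zero)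
qed simp

lemma finite_lists_of_length: "finite {as :: 'a::finite list. length as = m}"
  using finite_lists_length_eq[of "UNIV :: 'a set" m] by simp

lemma contract_flat:
  "(\<Sum>as\<in>{as. length as = m}. \<Sum>bs\<in>{bs. length bs = m}.
      (\<Prod>s<m. inv_metric flat_metric x (as ! s) (bs ! s)) * F as * G bs)
   = (\<Sum>as\<in>{as. length as = m}. F as * G as)"
proof (rule sum.cong[OF refl])
  fix as :: "'a list" assume as: "as \<in> {as. length as = m}"
  have "(\<Sum>bs\<in>{bs. length bs = m}.
      (\<Prod>s<m. inv_metric flat_metric x (as ! s) (bs ! s)) * F as * G bs)
    = (\<Sum>bs\<in>{bs. length bs = m}. if as = bs then F as * G bs else 0)"
    using as by (intro sum.cong) (auto simp: prod_kronecker_lists simp del: inv_metric_flat)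
  also have "\<dots> = F as * G as"
    using as by (simp add: finite_lists_of_length)
  finally show "(\<Sum>bs\<in>{bs. length bs = m}.
      (\<Prod>s<m. inv_metric flat_metric x (as ! s) (bs ! s)) * F as * G bs) = F as * G as" .
qed

lemma rho_flat:
  "rho flat_metric k \<omega> i j x = (\<Sum>as\<in>{as. length as = k - 1}. \<omega> x (i # as) * \<omega> x (j # as))"
  unfolding rho_def by (rule contract_flat)

lemma tensor_norm_sq_flat:
  assumes "k \<ge> 1"
  shows "tensor_norm_sq flat_metric k \<omega> x = (\<Sum>i\<in>UNIV. rho flat_metric k \<omega> i i x)"
proof -
  have *: "{as. length as = k} = (\<lambda>(i, as). i # as) ` (UNIV \<times> {as :: 'a list. length as = k - 1})"
    using assms by (cases k) (auto simp: image_iff length_Suc_conv)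
  have "tensor_norm_sq flat_metric k \<omega> x = (\<Sum>as\<in>{as. length as = k}. \<omega> x as * \<omega> x as)"
    unfolding tensor_norm_sq_def by (rule contract_flat)
  also have "\<dots> = (\<Sum>(i, as)\<in>UNIV \<times> {as. length as = k - 1}. \<omega> x (i # as) * \<omega> x (i # as))"
    unfolding * by (subst sum.reindex) (auto simp: inj_on_def case_prod_unfold)
  finally show ?thesis by (simp add: rho_flat sum.cartesian_product)
qed

section \<open>The top derivative of a block polynomial\<close>

lemma partial_deriv_block_poly:
  fixes B :: "'n::finite set set" and A :: "'n set"
  shows "partial_deriv p (\<lambda>x. \<Sum>I\<in>B. if Q I then c I * (\<Prod>i\<in>I - A. x $ i) else 0)
    = (\<lambda>x. \<Sum>I\<in>B. if Q I \<and> p \<in> I - A then c I * (\<Prod>i\<in>I - insert p A. x $ i) else 0)"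
proof
  fix x :: "real ^ 'n"
  have mono: "((\<lambda>x. \<Prod>i\<in>J. x $ i) has_derivative (\<lambda>h. \<Sum>i\<in>J. h $ i * (\<Prod>j\<in>J - {i}. x $ j))) (at x)"
    for J :: "'n set"
    by (intro has_derivative_prod bounded_linear_imp_has_derivative bounded_linear_vec_nth)
  have summand: "((\<lambda>x. if Q I then c I * (\<Prod>i\<in>I - A. x $ i) else 0) has_derivative
    (\<lambda>h. if Q I then c I * (\<Sum>i\<in>I - A. h $ i * (\<Prod>j\<in>I - A - {i}. x $ j)) else 0)) (at x)" for I
    by (cases "Q I") (auto intro!: has_derivative_mult_right mono)
  have delta: "(\<Sum>i\<in>J. axis p 1 $ i * (\<Prod>j\<in>J - {i}. x $ j))
      = (if p \<in> J then \<Prod>j\<in>J - {p}. x $ j else 0)" for J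
  proof -
    have "(\<Sum>i\<in>J. axis p 1 $ i * (\<Prod>j\<in>J - {i}. x $ j))
      = (\<Sum>i\<in>J. if p = i then \<Prod>j\<in>J - {i}. x $ j else 0)"
      by (intro sum.cong) (auto simp: axis_def)
    then show ?thesis by simp
  qed
  have "partial_deriv p (\<lambda>x. \<Sum>I\<in>B. if Q I then c I * (\<Prod>i\<in>I - A. x $ i) else 0) x
    = (\<Sum>I\<in>B. if Q I then c I * (\<Sum>i\<in>I - A. axis p 1 $ i * (\<Prod>j\<in>I - A - {i}. x $ j)) else 0)"
    by (rule partial_deriv_eqI, rule has_derivative_sum, rule summand)
  also have "\<dots> = (\<Sum>I\<in>B. if Q I \<and> p \<in> I - A then c I * (\<Prod>i\<in>I - insert p A. x $ i) else 0)"
    unfolding delta by (intro sum.cong) (auto simp: Diff_insert[symmetric])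
  finally show "partial_deriv p (\<lambda>x. \<Sum>I\<in>B. if Q I then c I * (\<Prod>i\<in>I - A. x $ i) else 0) x
    = (\<Sum>I\<in>B. if Q I \<and> p \<in> I - A then c I * (\<Prod>i\<in>I - insert p A. x $ i) else 0)" .
qed

text \<open>
  Differentiating a squarefree monomial removes a variable, so a repeated index, like an index
  outside the block, kills it.
\<close>

lemma foldr_partial_deriv_block_poly:
  fixes B :: "'n::finite set set"
  shows "foldr partial_deriv is (block_poly B \<epsilon>)
    = (\<lambda>x. \<Sum>I\<in>B. if distinct is \<and> set is \<subseteq> I then \<epsilon> I * (\<Prod>i\<in>I - set is. x $ i) else 0)"
proof (induction "is")
  case Nil
  then show ?case by (simp add: block_poly_def fun_eq_iff)
next
  case (Cons p "is")
  have "(distinct is \<and> set is \<subseteq> I) \<and> p \<in> I - set is \<longleftrightarrow> distinct (p # is) \<and> set (p # is) \<subseteq> I" for I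
    by auto
  moreover have "foldr partial_deriv (p # is) (block_poly B \<epsilon>)
      = partial_deriv p (foldr partial_deriv is (block_poly B \<epsilon>))"
    by simp
  ultimately show ?case
    unfolding Cons.IH partial_deriv_block_poly list.set by simp
qed

definition block_tensor :: "'n set set \<Rightarrow> ('n set \<Rightarrow> real) \<Rightarrow> 'n list \<Rightarrow> real" where
  "block_tensor B \<epsilon> is = (if distinct is \<and> set is \<in> B then \<epsilon> (set is) else 0)"

lemma iterated_cov_deriv_block_poly:
  fixes B :: "'n::finite set set"
  assumes "\<forall>I\<in>B. card I = k" and "length is = k"
  shows "iterated_cov_deriv flat_metric k (block_poly B \<epsilon>) x is = block_tensor B \<epsilon> is"
proof -
  have iff: "distinct is \<and> set is \<subseteq> I \<longleftrightarrow> distinct is \<and> set is = I" if "I \<in> B" for I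
    using that assms by (metis card_subset_eq distinct_card finite subset_refl)
  have "iterated_cov_deriv flat_metric k (block_poly B \<epsilon>) x is
    = (\<Sum>I\<in>B. if distinct is \<and> set is \<subseteq> I then \<epsilon> I * (\<Prod>i\<in>I - set is. x $ i) else 0)"
    by (simp add: iterated_cov_deriv_flat assms foldr_partial_deriv_block_poly)
  also have "\<dots> = (\<Sum>I\<in>B. if set is = I then if distinct is then \<epsilon> I else 0 else 0)"
    using iff by (intro sum.cong) auto
  also have "\<dots> = block_tensor B \<epsilon> is"
    by (simp add: block_tensor_def)
  finally show ?thesis .
qed

section \<open>The contraction of the block tensor with itself\<close>

lemma card_block_orderings:
  fixes B :: "'n::finite set set"
  assumes card: "\<forall>I\<in>B. card I = k" and "k \<ge> 1"
  shows "card {as. length as = k - 1 \<and> distinct (i # as) \<and> set (i # as) \<in> B}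
    = card {I \<in> B. i \<in> I} * fact (k - 1)"
proof -
  have "{as. length as = k - 1 \<and> distinct (i # as) \<and> set (i # as) \<in> B}
    = (\<Union>I\<in>{I \<in> B. i \<in> I}. permutations_of_set (I - {i}))" (is "?L = ?R")
  proof (intro set_eqI iffI)
    fix as assume "as \<in> ?L"
    then show "as \<in> ?R"
      by (auto simp: permutations_of_set_def intro!: bexI[of _ "insert i (set as)"])
  next
    fix as assume "as \<in> ?R"
    then obtain I where I: "I \<in> B" "i \<in> I" "set as = I - {i}" "distinct as"
      by (auto simp: permutations_of_set_def)
    then have "length as = k - 1" "insert i (set as) = I"
      using card by (auto simp: distinct_card[symmetric])
    then show "as \<in> ?L" using I by auto
  qed
  also have "card \<dots> = (\<Sum>I\<in>{I \<in> B. i \<in> I}. card (permutations_of_set (I - {i})))"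
    by (intro card_UN_disjoint) (auto dest: permutations_of_setD)
  also have "\<dots> = card {I \<in> B. i \<in> I} * fact (k - 1)"
    using card by simp
  finally show ?thesis .
qed

lemma sum_block_tensor_diagonal:
  fixes B :: "'n::finite set set"
  assumes "\<forall>I\<in>B. card I = k" and "k \<ge> 1" and sign: "\<forall>I\<in>B. \<epsilon> I \<in> {-1, 1}"
  shows "(\<Sum>as\<in>{as. length as = k - 1}. block_tensor B \<epsilon> (i # as) * block_tensor B \<epsilon> (i # as))
    = real (card {I \<in> B. i \<in> I}) * fact (k - 1)"
proof -
  have "(\<Sum>as\<in>{as. length as = k - 1}. block_tensor B \<epsilon> (i # as) * block_tensor B \<epsilon> (i # as))
    = (\<Sum>as\<in>{as. length as = k - 1}. if distinct (i # as) \<and> set (i # as) \<in> B then 1 else 0)"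
    using sign by (intro sum.cong) (force simp: block_tensor_def)+
  also have "\<dots> = real (card {as. length as = k - 1 \<and> distinct (i # as) \<and> set (i # as) \<in> B})"
    by (simp add: sum.If_cases finite_lists_of_length Int_def)
  finally show ?thesis using card_block_orderings[OF assms(1,2)] by simp
qed

text \<open>
  A nonzero term extends the \<open>k - 1 \<ge> 2\<close> points of \<open>as\<close> to a block by \<open>i\<close> and also by \<open>j\<close>, which
  gives two blocks with too large an intersection.
\<close>

lemma sum_block_tensor_off_diagonal:
  fixes B :: "'n::finite set set"
  assumes "k \<ge> 3" and "i \<noteq> j"
    and inter: "\<And>I J. I \<in> B \<Longrightarrow> J \<in> B \<Longrightarrow> I \<noteq> J \<Longrightarrow> card (I \<inter> J) \<le> 1"
  shows "(\<Sum>as\<in>{as. length as = k - 1}. block_tensor B \<epsilon> (i # as) * block_tensor B \<epsilon> (j # as)) = 0"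
proof (rule sum.neutral, rule ballI, rule ccontr)
  fix as assume as: "as \<in> {as. length as = k - 1}"
    and "block_tensor B \<epsilon> (i # as) * block_tensor B \<epsilon> (j # as) \<noteq> 0"
  then have d: "distinct as" "i \<notin> set as" "j \<notin> set as"
    and mem: "insert i (set as) \<in> B" "insert j (set as) \<in> B"
    by (auto simp: block_tensor_def split: if_splits)
  have "insert i (set as) \<inter> insert j (set as) = set as" "insert i (set as) \<noteq> insert j (set as)"
    using d \<open>i \<noteq> j\<close> by auto
  then have "card (set as) \<le> 1" using inter[OF mem] by simp
  then show False using as d \<open>k \<ge> 3\<close> by (simp add: distinct_card)
qed

section \<open>Uniform set systems with small intersections and constant replication\<close>

text \<open>
  Here \<open>\<rho> = r (k - 1)! h\<close> and so \<open>|\<omega>|\<^sup>2 = n r (k - 1)!\<close>.  The value of \<open>\<kappa>\<close> solves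
  \<open>(n - 2) / (2 n) \<kappa> = c r (k - 1)! (1 - n / 2)\<close>.
\<close>

lemma coupled_einstein_block_poly:
  fixes B :: "'n::finite set set"
  assumes k: "k \<ge> 3" and card: "\<forall>I\<in>B. card I = k"
    and inter: "\<And>I J. I \<in> B \<Longrightarrow> J \<in> B \<Longrightarrow> I \<noteq> J \<Longrightarrow> card (I \<inter> J) \<le> 1"
    and repl: "\<And>i. card {I \<in> B. i \<in> I} = r"
    and sign: "\<forall>I\<in>B. \<epsilon> I \<in> {-1, 1}"
  shows "coupled_einstein flat_metric k (iterated_cov_deriv flat_metric k (block_poly B \<epsilon>)) c
    (- (real CARD('n) * real r * fact (k - 1) * c))"
proof -
  define \<omega> where "\<omega> = iterated_cov_deriv flat_metric k (block_poly B \<epsilon>)"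
  have \<omega>: "\<omega> x is = block_tensor B \<epsilon> is" if "length is = k" for x "is"
    using iterated_cov_deriv_block_poly[OF card that] by (simp add: \<omega>_def)
  have smooth: "smooth_tensor k \<omega>"
    by (simp add: smooth_tensor_def \<omega> smooth_fun_const)
  have symm: "symmetric_tensor k \<omega>"
    unfolding symmetric_tensor_def
  proof (intro allI impI)
    fix x :: "real ^ 'n" and "is" js :: "'n list"
    assume *: "length is = k \<and> mset is = mset js"
    then have "length js = k" "distinct js = distinct is" "set js = set is"
      by (metis size_mset, metis mset_eq_imp_distinct_iff, metis set_mset_mset)
    then show "\<omega> x is = \<omega> x js" using * by (simp add: \<omega> block_tensor_def)
  qed
  have trace: "trace_free flat_metric k \<omega>"
    unfolding trace_free_def by (auto simp: \<omega> block_tensor_def intro!: sum.neutral)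
  have deriv: "cov_deriv flat_metric \<omega> x (p # is) = 0" if "length is = k" for x p "is"
    using that by (simp add: \<omega> del: cov_deriv.simps)
  have div: "divergence_free flat_metric k \<omega>"
    unfolding divergence_free_def by (simp add: deriv del: cov_deriv.simps cov_deriv_flat)
  have cod: "codazzi flat_metric k \<omega>"
    unfolding codazzi_def by (simp add: deriv del: cov_deriv.simps cov_deriv_flat)
  have rho: "rho flat_metric k \<omega> i j x = (if i = j then real r * fact (k - 1) else 0)" for i j x
  proof -
    have "rho flat_metric k \<omega> i j x
      = (\<Sum>as\<in>{as. length as = k - 1}. block_tensor B \<epsilon> (i # as) * block_tensor B \<epsilon> (j # as))"
      unfolding rho_flat using k by (intro sum.cong) (auto simp: \<omega>)
    then show ?thesis
      using sum_block_tensor_diagonal[OF card _ sign, of i] k repl[of i]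
        sum_block_tensor_off_diagonal[OF k _ inter, of i j] by auto
  qed
  have norm: "tensor_norm_sq flat_metric k \<omega> x = real CARD('n) * real r * fact (k - 1)" for x
    using k by (subst tensor_norm_sq_flat) (simp_all add: rho)
  show ?thesis
    unfolding coupled_einstein_def \<omega>_def[symmetric]
  proof (intro conjI allI riemannian_metric_flat smooth symm trace div cod)
    fix x :: "real ^ 'n" and i j :: 'n
    show "ricci flat_metric i j x - (1/2) * scal flat_metric x * flat_metric x $ i $ j
        + (real CARD('n) - 2) / (2 * real CARD('n)) * (- (real CARD('n) * real r * fact (k - 1) * c))
          * flat_metric x $ i $ j
        = c * (rho flat_metric k \<omega> i j x
            - (1/2) * tensor_norm_sq flat_metric k \<omega> x * flat_metric x $ i $ j)"
      by (simp add: rho norm) (simp add: flat_metric_def mat_def field_simps)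
  qed
qed

section \<open>The blocks of a regular graph\<close>

definition star :: "('n \<Rightarrow> 'v set) \<Rightarrow> 'v \<Rightarrow> 'n set" where
  "star e v = {i. v \<in> e i}"

lemma card_star:
  assumes "regular_graph k V E" and "bij_betw e UNIV E" and "v \<in> V"
  shows "card (star e v) = k"
proof -
  have "e ` star e v = {a \<in> E. v \<in> a}"
    using assms(2) by (auto simp: bij_betw_def star_def)
  moreover have "inj_on e (star e v)"
    using assms(2) by (auto simp: bij_betw_def intro: inj_on_subset)
  ultimately have "card (star e v) = card {a \<in> E. v \<in> a}"
    by (metis card_image)
  then show ?thesis using assms by (simp add: regular_graph_def)
qed

text \<open>By \<open>k\<close>-regularity there are only \<open>k\<close> edges at a vertex, so they form its only block.\<close>

lemma incidence_blocks_regular: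
  fixes e :: "'n::finite \<Rightarrow> 'v set"
  assumes "regular_graph k V E" and "bij_betw e UNIV E"
  shows "incidence_blocks V e k = star e ` V"
proof (intro set_eqI iffI)
  fix I assume "I \<in> incidence_blocks V e k"
  then obtain v where "card I = k" "v \<in> V" "I \<subseteq> star e v"
    by (auto simp: incidence_blocks_def star_def)
  then show "I \<in> star e ` V"
    using card_star[OF assms] card_subset_eq[of "star e v" I] by auto
qed (use card_star[OF assms] in \<open>auto simp: incidence_blocks_def star_def\<close>)

lemma card_star_inter:
  fixes e :: "'n::finite \<Rightarrow> 'v set"
  assumes "finite_simple_graph V E" and "bij_betw e UNIV E" and "v \<noteq> w"
  shows "card (star e v \<inter> star e w) \<le> 1"
proof -
  have "e i = {v, w}" if "i \<in> star e v \<inter> star e w" for i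
  proof -
    have "card (e i) = 2"
      using assms(1,2) by (auto simp: finite_simple_graph_def bij_betw_def)
    then show ?thesis
      using that \<open>v \<noteq> w\<close> by (auto simp: star_def card_2_iff)
  qed
  then have "i = j" if "i \<in> star e v \<inter> star e w" "j \<in> star e v \<inter> star e w" for i j
    using that assms(2) by (metis bij_betw_def injD)
  then show ?thesis by (auto simp: card_le_Suc0_iff_eq)
qed

text \<open>
  The two ends of an edge give different blocks: stars have \<open>k \<ge> 2\<close> elements, but distinct
  vertices share at most one edge.
\<close>

lemma card_blocks_through_edge:
  fixes e :: "'n::finite \<Rightarrow> 'v set"
  assumes "finite_simple_graph V E" and "regular_graph k V E" and "bij_betw e UNIV E" and "k \<ge> 2"
  shows "card {I \<in> star e ` V. i \<in> I} = 2"
proof -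
  have "e i \<in> E" using assms(3) by (auto simp: bij_betw_def)
  then have e: "e i \<subseteq> V" "card (e i) = 2"
    using assms(1) by (auto simp: finite_simple_graph_def)
  have "inj_on (star e) V"
  proof (rule inj_onI, rule ccontr)
    fix v w assume "v \<in> V" "star e v = star e w" "v \<noteq> w"
    then show False
      using card_star_inter[OF assms(1,3), of v w] card_star[OF assms(2,3), of v] \<open>k \<ge> 2\<close> by simp
  qed
  then have "card (star e ` e i) = 2"
    using e by (metis card_image inj_on_subset)
  moreover have "{I \<in> star e ` V. i \<in> I} = star e ` e i"
    using e by (auto simp: star_def)
  ultimately show ?thesis by simp
qed

theorem theorem4p18:
  fixes V :: "'v set" and E :: "'v set set"
    and e :: "'n::finite \<Rightarrow> 'v set"
    and k :: nat
    and \<epsilon> :: "'n set \<Rightarrow> real"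
  assumes "finite_simple_graph V E"
    and "k \<ge> 3"
    and "regular_graph k V E"
    and "bij_betw e UNIV E"
    and "\<forall>I \<in> incidence_blocks V e k. \<epsilon> I \<in> {-1, 1}"
  shows "\<forall>c. \<exists>\<kappa>. coupled_einstein flat_metric k
           (iterated_cov_deriv flat_metric k (block_poly (incidence_blocks V e k) \<epsilon>)) c \<kappa>"
proof -
  have blocks: "incidence_blocks V e k = star e ` V"
    by (rule incidence_blocks_regular) fact+
  have card: "\<forall>I\<in>star e ` V. card I = k"
    using card_star[OF assms(3,4)] by auto
  have inter: "card (I \<inter> J) \<le> 1" if "I \<in> star e ` V" "J \<in> star e ` V" "I \<noteq> J" for I J
    using that card_star_inter[OF assms(1,4)] by (metis imageE)
  have repl: "card {I \<in> star e ` V. i \<in> I} = 2" for i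
    using card_blocks_through_edge[OF assms(1,3,4)] assms(2) by simp
  show ?thesis
    unfolding blocks
    by (intro allI exI, rule coupled_einstein_block_poly[OF assms(2) card inter repl assms(5)[unfolded blocks]])
qed

end
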